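(* Let $m\ge 1$ be the number of components of a one-dimensional hyperbolic system, let $I$ be a mesh cell (a nondegenerate bounded interval), and for each $i\in\{1,\dots,m\}$ let $\phi_{i,0},\dots,\phi_{i,K_i}$ be a basis of the space of real polynomials of degree at most $K_i$ on $I$, used to represent the $i$-th component. Suppose that all components share the same set of basis functions, i.e. $K_1=K_2=\cdots=K_m=K$ and $\phi_{1,k}\equiv\phi_{2,k}\equiv\cdots\equiv\phi_{m,k}$ for all $k\in\{0,1,\dots,K\}$. Let $x_0,\dots,x_K\in I$ be pairwise distinct sampling points, let $\mathbb{L}$ be the (locally frozen, constant) $m\times m$ left eigenvector matrix, and let $u_i=\sum_{k=0}^{K}\alpha_k^{(i)}\phi_{i,k}$, $i=1,\dots,m$, be polynomials with real coefficients $\alpha_k^{(i)}$. Then $\mathbb{P}^{(1)}=\mathbb{P}^{(2)}=\cdots=\mathbb{P}^{(m)}$, and the interpolation-based characteristic transformation is equivalent to the moment characteristic transformation, i.e. $$\widetilde{\mathbf{a}}^{(i)}=\mathbf{b}^{(i)}\qquad\text{for all } i\in\{1,\dots,m\},$$ where $\mathbb{P}^{(i)}$, $\widetilde{\mathbf{a}}^{(i)}$ and $\mathbf{b}^{(i)}$ are as defined in the context.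
   Context: Consider a one-dimensional hyperbolic system $\partial_t\mathbf{U}+\partial_x\mathbf{F}(\mathbf{U})=0$ with $\mathbf{U}=(u_1,\dots,u_m)^{\mathrm T}$. Its flux Jacobian, frozen at a fixed state, is a constant matrix $\mathbb{J}=\mathbb{R}\Lambda\mathbb{L}$ with $\Lambda$ diagonal and $\mathbb{R}\mathbb{L}$ the $m\times m$ identity; $\mathbb{L}=(l_{ij})$ is called the left eigenvector matrix. Moment characteristic transformation: let $\mathbb{A}$ be the $m\times(K+1)$ matrix whose $i$-th row is $[\mathbf{a}^{(i)}]^{\mathrm T}=(\alpha_0^{(i)},\dots,\alpha_K^{(i)})$, the coefficients of $u_i$ in the basis $\phi_{i,0},\dots,\phi_{i,K}$. Put $\mathbb{B}=\mathbb{L}\mathbb{A}$, and let $[\mathbf{b}^{(i)}]^{\mathrm T}$ be the $i$-th row of $\mathbb{B}$. The vector $\mathbf{b}^{(i)}$ is the coefficient vector, in the basis $\phi_{i,0},\dots,\phi_{i,K}$, of the $i$-th characteristic polynomial. Interpolation-based characteristic transformation: let $\mathbf{Y}^{(i)}=(u_i(x_0),\dots,u_i(x_K))^{\mathrm T}$, let $\mathbb{Y}$ be the $m\times(K+1)$ matrix whose $i$-th row is $[\mathbf{Y}^{(i)}]^{\mathrm T}$, put $\widetilde{\mathbb{Y}}=\mathbb{L}\mathbb{Y}$, and let $[\widetilde{\mathbf{Y}}^{(i)}]^{\mathrm T}$ be the $i$-th row of $\widetilde{\mathbb{Y}}$. Let $\mathbb{P}^{(i)}$ be the $(K+1)\times(K+1)$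 matrix with entries $\mathbb{P}^{(i)}_{jk}=\phi_{i,k}(x_j)$, $0\le j,k\le K$ (it is invertible, since the sampling points are pairwise distinct and the $\phi_{i,k}$ form a basis of the polynomials of degree at most $K$). The coefficient vector of the $i$-th characteristic polynomial is then $\widetilde{\mathbf{a}}^{(i)}=[\mathbb{P}^{(i)}]^{-1}\widetilde{\mathbf{Y}}^{(i)}$, i.e. $\widetilde u_i=\sum_{k=0}^K\widetilde\alpha^{(i)}_k\phi_{i,k}$ is the polynomial with $\widetilde u_i(x_j)=\widetilde{\mathbf{Y}}^{(i)}_j$ for all $j$. *)

theory Defs
  imports
    "HOL-Analysis.Topology_Euclidean_Space"
    "Jordan_Normal_Form.Gauss_Jordan_Elimination"
    "Jordan_Normal_Form.Determinant"
begin

(* Components i = 1, ..., m are numbered 0, ..., m - 1. Basis functions and sampling points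
   are numbered 0, ..., K. *)

definition mesh_cell :: "real set \<Rightarrow> bool" where
  "mesh_cell I \<longleftrightarrow> is_interval I \<and> bounded I \<and> interior I \<noteq> {}"

(* Polynomials are formal; on a mesh cell, which is infinite, a formal polynomial and its
   polynomial function determine each other. Injectivity makes this a statement about the
   indexed family, not only about its set of values. *)
definition poly_basis :: "nat \<Rightarrow> (nat \<Rightarrow> real poly) \<Rightarrow> bool" where
  "poly_basis K \<phi> \<longleftrightarrow>
     inj_on \<phi> {..K} \<and>
     \<not> module.dependent smult (\<phi> ` {..K}) \<and>
     module.span smult (\<phi> ` {..K}) = {p. degree p \<le> K}"

(* J(i,j) is the partial derivative of the i-th component of F in the j-th variable at U. *)
definition flux_jacobian ::
    "nat \<Rightarrow> (real vec \<Rightarrow> real vec) \<Rightarrow> real vec \<Rightarrow> real mat \<Rightarrow> bool" where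
  "flux_jacobian m F U J \<longleftrightarrow>
     J \<in> carrier_mat m m \<and>
     (\<forall>i<m. \<forall>j<m.
        ((\<lambda>s. F (U + s \<cdot>\<^sub>v unit_vec m j) $ i) has_real_derivative J $$ (i, j)) (at 0))"

definition left_eigenvector_mat ::
    "nat \<Rightarrow> (real vec \<Rightarrow> real vec) \<Rightarrow> real vec \<Rightarrow> real mat \<Rightarrow> bool" where
  "left_eigenvector_mat m F U L \<longleftrightarrow>
     L \<in> carrier_mat m m \<and>
     (\<exists>J R D. flux_jacobian m F U J \<and>
        R \<in> carrier_mat m m \<and> D \<in> carrier_mat m m \<and> diagonal_mat D \<and>
        J = R * D * L \<and> R * L = 1\<^sub>m m)"

definition coeff_mat :: "nat \<Rightarrow> nat \<Rightarrow> (nat \<Rightarrow> nat \<Rightarrow> real) \<Rightarrow> real mat" where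
  "coeff_mat m K \<alpha> = mat m (K + 1) (\<lambda>(i, k). \<alpha> i k)"

definition sample_mat ::
    "nat \<Rightarrow> nat \<Rightarrow> (nat \<Rightarrow> real poly) \<Rightarrow> (nat \<Rightarrow> real) \<Rightarrow> real mat" where
  "sample_mat m K u x = mat m (K + 1) (\<lambda>(i, j). poly (u i) (x j))"

definition basis_eval_mat ::
    "nat \<Rightarrow> (nat \<Rightarrow> real poly) \<Rightarrow> (nat \<Rightarrow> real) \<Rightarrow> real mat" where
  "basis_eval_mat K \<psi> x = mat (K + 1) (K + 1) (\<lambda>(j, k). poly (\<psi> k) (x j))"

definition moment_char_coeffs ::
    "nat \<Rightarrow> nat \<Rightarrow> real mat \<Rightarrow> (nat \<Rightarrow> nat \<Rightarrow> real) \<Rightarrow> nat \<Rightarrow> real vec" where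
  "moment_char_coeffs m K L \<alpha> i = row (L * coeff_mat m K \<alpha>) i"

(* The inverse exists for a basis and pairwise distinct points: basis_eval_mat_inverse below. *)
definition interp_char_coeffs ::
    "nat \<Rightarrow> nat \<Rightarrow> real mat \<Rightarrow> (nat \<Rightarrow> nat \<Rightarrow> real poly) \<Rightarrow> (nat \<Rightarrow> real)
      \<Rightarrow> (nat \<Rightarrow> real poly) \<Rightarrow> nat \<Rightarrow> real vec" where
  "interp_char_coeffs m K L \<phi> x u i =
     the (mat_inverse (basis_eval_mat K (\<phi> i) x)) *\<^sub>v row (L * sample_mat m K u x) i"

lemma det_basis_eval_mat_nonzero:
  assumes b: "poly_basis K \<psi>" and x: "inj_on x {..K}"
  shows "det (basis_eval_mat K \<psi> x) \<noteq> 0"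
proof
  interpret vs: vector_space "smult :: real \<Rightarrow> real poly \<Rightarrow> real poly"
    by unfold_locales (auto simp: smult_add_right smult_add_left)
  have inj: "inj_on \<psi> {..K}" and ind: "\<not> vs.dependent (\<psi> ` {..K})"
    and span: "vs.span (\<psi> ` {..K}) = {p. degree p \<le> K}"
    using b unfolding poly_basis_def by auto
  let ?P = "basis_eval_mat K \<psi> x"
  have P: "?P \<in> carrier_mat (K + 1) (K + 1)"
    by (simp add: basis_eval_mat_def)
  assume "det ?P = 0"
  then obtain v where v: "v \<in> carrier_vec (K + 1)" "v \<noteq> 0\<^sub>v (K + 1)" "?P *\<^sub>v v = 0\<^sub>v (K + 1)"
    using det_0_iff_vec_prod_zero[OF P] by auto
  define p where "p = (\<Sum>k\<le>K. smult (v $ k) (\<psi> k))"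
  have root: "poly p (x j) = 0" if "j \<le> K" for j
  proof -
    have "0 = (?P *\<^sub>v v) $ j"
      using v(3) that by simp
    also have "\<dots> = (\<Sum>k\<in>{0..<K+1}. poly (\<psi> k) (x j) * v $ k)"
      using that v(1) by (simp add: basis_eval_mat_def scalar_prod_def)
    also have "\<dots> = poly p (x j)"
      by (simp add: p_def poly_sum mult.commute atLeast0LessThan lessThan_Suc_atMost)
    finally show ?thesis by simp
  qed
  have "p \<in> vs.span (\<psi> ` {..K})"
    unfolding p_def by (intro vs.span_sum vs.span_scale vs.span_base) auto
  then have deg: "degree p \<le> K"
    using span by auto
  have "p = 0"
  proof (rule ccontr)
    assume "p \<noteq> 0"
    then have "card {z. poly p z = 0} \<le> K"
      using card_poly_roots_bound[of p] deg by simp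
    moreover have "card (x ` {..K}) \<le> card {z. poly p z = 0}"
      using root by (intro card_mono poly_roots_finite \<open>p \<noteq> 0\<close>) auto
    ultimately show False
      using card_image[OF x] by simp
  qed
  then have "(\<Sum>q\<in>\<psi> ` {..K}. smult (v $ (the_inv_into {..K} \<psi> q)) q) = 0"
    using inj by (simp add: p_def sum.reindex the_inv_into_f_f)
  then have "v $ k = 0" if "k \<le> K" for k
    using vs.independentD[OF ind _ subset_refl, of "\<lambda>q. v $ (the_inv_into {..K} \<psi> q)" "\<psi> k"]
      inj that by (simp add: the_inv_into_f_f)
  then have "v = 0\<^sub>v (K + 1)"
    using v(1) by (intro eq_vecI) auto
  with v(2) show False by simp
qed

lemma basis_eval_mat_inverse:
  assumes "poly_basis K \<psi>" and "inj_on x {..K}"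
  obtains Q where "mat_inverse (basis_eval_mat K \<psi> x) = Some Q"
    and "Q \<in> carrier_mat (K + 1) (K + 1)"
    and "basis_eval_mat K \<psi> x * Q = 1\<^sub>m (K + 1)" and "Q * basis_eval_mat K \<psi> x = 1\<^sub>m (K + 1)"
proof -
  let ?P = "basis_eval_mat K \<psi> x"
  have P: "?P \<in> carrier_mat (K + 1) (K + 1)"
    by (simp add: basis_eval_mat_def)
  have "?P \<in> Units (ring_mat TYPE(real) (K + 1) ())"
    using det_non_zero_imp_unit[OF P det_basis_eval_mat_nonzero[OF assms]] .
  then obtain Q where "mat_inverse ?P = Some Q"
    using mat_inverse(1)[OF P, of "()"] by (cases "mat_inverse ?P") auto
  with mat_inverse(2)[OF P this] that show ?thesis by blast
qed

end

theory Submission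
  imports Defs
begin

text \<open>
  Mixing components commutes with passing between coefficients and samples. The left
  eigenvector matrix mixes components, so it multiplies a matrix of coefficients or samples
  from the left. Sampling a polynomial acts on each component separately; when all components
  share one basis, it is the same linear map on every row, hence a multiplication from the right
  by the transpose of the common evaluation matrix: \<open>Y = A P\<^sup>T\<close>
  (\<open>sample_mat_eq_coeff_mat_mult\<close>). By associativity \<open>L Y = (L A) P\<^sup>T\<close>, so the \<open>i\<close>-th row of
  characteristic samples is \<open>P b\<close>, where \<open>b\<close> is the \<open>i\<close>-th row of moment characteristic
  coefficients. Interpolation applies the inverse of \<open>P\<close> and returns \<open>b\<close>.

  With different bases each row of \<open>Y\<close> would involve its own evaluation matrix, and a row of
  \<open>L A\<close> would combine coordinates taken in different bases.
\<close>

lemma row_mult_transpose: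
  fixes B P :: "'a :: comm_semiring_0 mat"
  assumes "B \<in> carrier_mat m n" and "P \<in> carrier_mat r n" and "i < m"
  shows "row (B * transpose_mat P) i = P *\<^sub>v row B i"
proof (rule eq_vecI)
  show "row (B * transpose_mat P) i $ j = (P *\<^sub>v row B i) $ j"
    if "j < dim_vec (P *\<^sub>v row B i)" for j
    using that assms by (simp add: comm_scalar_prod[of _ n])
  show "dim_vec (row (B * transpose_mat P) i) = dim_vec (P *\<^sub>v row B i)"
    using assms by simp
qed

text \<open>
  This is where the common basis enters: a single matrix \<open>P\<close> converts the coefficients of every
  component into samples, so the conversion is a multiplication on the side opposite to \<open>L\<close>.
\<close>

lemma sample_mat_eq_coeff_mat_mult:
  assumes "\<And>i. i < m \<Longrightarrow> u i = (\<Sum>k\<le>K. smult (\<alpha> i k) (\<psi> k))"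
  shows "sample_mat m K u x = coeff_mat m K \<alpha> * transpose_mat (basis_eval_mat K \<psi> x)"
proof (rule eq_matI)
  fix i j
  assume "i < dim_row (coeff_mat m K \<alpha> * transpose_mat (basis_eval_mat K \<psi> x))"
    and "j < dim_col (coeff_mat m K \<alpha> * transpose_mat (basis_eval_mat K \<psi> x))"
  then have i: "i < m" and j: "j < K + 1"
    by (simp_all add: coeff_mat_def basis_eval_mat_def)
  have "poly (u i) (x j) = (\<Sum>k\<in>{0..<K+1}. \<alpha> i k * poly (\<psi> k) (x j))"
    using assms[OF i] by (simp add: poly_sum atLeast0LessThan lessThan_Suc_atMost)
  then show "sample_mat m K u x $$ (i, j)
      = (coeff_mat m K \<alpha> * transpose_mat (basis_eval_mat K \<psi> x)) $$ (i, j)"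
    using i j
    by (simp add: sample_mat_def coeff_mat_def basis_eval_mat_def scalar_prod_def)
qed (simp_all add: sample_mat_def coeff_mat_def basis_eval_mat_def)

text \<open>
  Interpolation amounts to a left inverse \<open>Q\<close> of \<open>P\<close> applied to characteristic samples of the form
  \<open>P b\<close>. Only row \<open>i\<close> is compared, so the common basis is written as \<open>\<phi> i\<close>: it is the one whose
  evaluation matrix is inverted for that row.
\<close>

lemma interp_char_coeffs_eq_moment_char_coeffs:
  assumes L: "L \<in> carrier_mat m m"
    and basis: "poly_basis K (\<phi> i)" and x: "inj_on x {..K}"
    and u: "\<And>j. j < m \<Longrightarrow> u j = (\<Sum>k\<le>K. smult (\<alpha> j k) (\<phi> i k))"
    and i: "i < m"
  shows "interp_char_coeffs m K L \<phi> x u i = moment_char_coeffs m K L \<alpha> i"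
proof -
  define P where "P = basis_eval_mat K (\<phi> i) x"
  define A where "A = coeff_mat m K \<alpha>"
  have P: "P \<in> carrier_mat (K + 1) (K + 1)"
    by (simp add: P_def basis_eval_mat_def)
  have A: "A \<in> carrier_mat m (K + 1)"
    by (simp add: A_def coeff_mat_def)
  have LA: "L * A \<in> carrier_mat m (K + 1)"
    using L A by simp
  obtain Q where inv: "mat_inverse P = Some Q"
    and Q: "Q \<in> carrier_mat (K + 1) (K + 1)" and QP: "Q * P = 1\<^sub>m (K + 1)"
    by (rule basis_eval_mat_inverse[OF basis x, folded P_def]) (rule that)
  have "L * sample_mat m K u x = L * (A * transpose_mat P)"
    using sample_mat_eq_coeff_mat_mult[where x = x, OF u]
    by (simp add: A_def P_def)
  also have "\<dots> = (L * A) * transpose_mat P"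
    using assoc_mult_mat[OF L A transpose_carrier_mat[THEN iffD2, OF P]] by simp
  finally have "row (L * sample_mat m K u x) i = P *\<^sub>v row (L * A) i"
    using row_mult_transpose[OF LA P i] by simp
  then have "interp_char_coeffs m K L \<phi> x u i = Q *\<^sub>v (P *\<^sub>v row (L * A) i)"
    by (simp add: interp_char_coeffs_def inv flip: P_def)
  also have "\<dots> = (Q * P) *\<^sub>v row (L * A) i"
    using assoc_mult_mat_vec[OF Q P row_carrier_vec[OF i LA]] by simp
  also have "\<dots> = moment_char_coeffs m K L \<alpha> i"
    using row_carrier_vec[OF i LA] by (simp add: QP moment_char_coeffs_def flip: A_def)
  finally show ?thesis .
qed

theorem proposition8p1:
  fixes m K :: nat
    and Ks :: "nat \<Rightarrow> nat"
    and I :: "real set"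
    and \<phi> :: "nat \<Rightarrow> nat \<Rightarrow> real poly"
    and x :: "nat \<Rightarrow> real"
    and F :: "real vec \<Rightarrow> real vec"
    and U :: "real vec"
    and L :: "real mat"
    and \<alpha> :: "nat \<Rightarrow> nat \<Rightarrow> real"
    and u :: "nat \<Rightarrow> real poly"
  assumes "m \<ge> 1"
    and "mesh_cell I"
    and "\<forall>i<m. poly_basis (Ks i) (\<phi> i)"
    and "\<forall>i<m. Ks i = K"
    and "\<forall>i<m. \<forall>j<m. \<forall>k\<le>K. \<phi> i k = \<phi> j k"
    and "\<forall>j\<le>K. x j \<in> I"
    and "inj_on x {..K}"
    and "U \<in> carrier_vec m"
    and "\<forall>V\<in>carrier_vec m. F V \<in> carrier_vec m"
    and "left_eigenvector_mat m F U L"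
    and "\<forall>i<m. u i = (\<Sum>k\<le>K. smult (\<alpha> i k) (\<phi> i k))"
  shows "(\<forall>i<m. \<forall>j<m. basis_eval_mat K (\<phi> i) x = basis_eval_mat K (\<phi> j) x)
    \<and> (\<forall>i<m. interp_char_coeffs m K L \<phi> x u i = moment_char_coeffs m K L \<alpha> i)"
proof (intro conjI allI impI)
  fix i j assume "i < m" "j < m"
  then have "\<phi> i k = \<phi> j k" if "k < K + 1" for k
    by (rule assms(5)[rule_format]) (use that in simp)
  then show "basis_eval_mat K (\<phi> i) x = basis_eval_mat K (\<phi> j) x"
    unfolding basis_eval_mat_def by (intro cong_mat) auto
next
  fix i assume i: "i < m"
  have "u j = (\<Sum>k\<le>K. smult (\<alpha> j k) (\<phi> i k))" if j: "j < m" for j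
  proof -
    have "u j = (\<Sum>k\<le>K. smult (\<alpha> j k) (\<phi> j k))"
      using assms(11) j by simp
    also have "\<dots> = (\<Sum>k\<le>K. smult (\<alpha> j k) (\<phi> i k))"
      by (intro sum.cong refl arg_cong[where f = "smult _"] assms(5)[rule_format] j i) simp
    finally show ?thesis .
  qed
  moreover have "L \<in> carrier_mat m m"
    using assms(10) by (simp add: left_eigenvector_mat_def)
  moreover have "poly_basis K (\<phi> i)"
    using assms(3,4) i by auto
  ultimately show "interp_char_coeffs m K L \<phi> x u i = moment_char_coeffs m K L \<alpha> i"
    using assms(7) i by (intro interp_char_coeffs_eq_moment_char_coeffs)
qed

end
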